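(* Let $L,R$ be positive integers and let $\mathcal{N}\subseteq\{-L,\ldots,R\}$ be a set with $-L\in\mathcal{N}$ and $R\in\mathcal{N}$, such that the directed graph with vertex set $\mathbb{Z}$ and edge set $E=\{(x,y)\in\mathbb{Z}\times\mathbb{Z}: y-x\in\mathcal{N}\}$ is strongly connected. Then there is a finite collection $\mathscr{S}$ of finite, strongly connected sets $S\subset\mathbb{Z}$ (depending only on $L$, $R$ and $\mathcal{N}$) such that for every choice of positive real weights $(\alpha_i)_{i\in\mathcal{N}}$, there is some $S\in\mathscr{S}$ with $\kappa_0=\beta_S$, where $\kappa_0$ and $\beta_S$ are computed using the weights $(\alpha_i)_{i\in\mathcal{N}}$.
   Context: Given $L$, $R$, $\mathcal{N}$ as in the claim and positive reals $(\alpha_i)_{i\in\mathcal{N}}$, let $\mathcal{G}=(\mathbb{Z},E,w)$ be the shift-invariant weighted directed graph with vertex set $\mathbb{Z}$, edge set $E=\{(x,y)\in\mathbb{Z}\times\mathbb{Z}: y-x\in\mathcal{N}\}$, and weights $w((x,y))=\alpha_{y-x}$ for $(x,y)\in E$. (The value $0\in\mathcal{N}$, i.e. loops at each vertex, is allowed. Put $\alpha_i=0$ for $i\in\{-L,\ldots,R\}\setminus\mathcal{N}$; thus $\mathcal{N}$ is the set of $i$ for which $\alpha_i>0$.) The edge $e=(x,y)$ goes from its tail $\underline{e}=x$ to its head $\overline{e}=y$. A nonempty set $S\subseteq\mathbb{Z}$ is strongly connected if for all $x,y\in S$ (including $x=y$) there is a directed path with at least one edge from $x$ to $y$ in $\mathcal{G}$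 using only vertices in $S$. In particular, a singleton is strongly connected if and only if $0\in\mathcal{N}$. The graph is strongly connected if $\mathbb{Z}$ is a strongly connected set. Note that strong connectedness depends only on $\mathcal{N}$, not on the values of the weights. For $S\subseteq\mathbb{Z}$ finite, the total weight exiting $S$ is $$\beta_S:=\sum_{e\in E:\ \underline{e}\in S,\ \overline{e}\notin S}w(e),$$ and $$\kappa_0:=\inf\{\beta_S: S\subset\mathbb{Z}\text{ finite, nonempty, strongly connected}\}.$$ *)

theory Defs
  imports Complex_Main
begin

definition edges :: "int set \<Rightarrow> (int \<times> int) set" where
  "edges N = {(x, y). y - x \<in> N}"

definition weight :: "(int \<Rightarrow> real) \<Rightarrow> int \<times> int \<Rightarrow> real" where
  "weight \<alpha> = (\<lambda>(x, y). \<alpha> (y - x))"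

text \<open>The transitive closure asks for at least one edge also when \<open>x = y\<close>, so a singleton
  is strongly connected only if it carries a loop.\<close>

definition strongly_connected :: "('v \<times> 'v) set \<Rightarrow> 'v set \<Rightarrow> bool" where
  "strongly_connected E S \<longleftrightarrow>
     S \<noteq> {} \<and> (\<forall>x\<in>S. \<forall>y\<in>S. (x, y) \<in> (E \<inter> S \<times> S)\<^sup>+)"

text \<open>The index set is finite when \<open>E = edges N\<close> with \<open>N\<close> and \<open>S\<close> finite.\<close>

definition exit_weight :: "('v \<times> 'v) set \<Rightarrow> ('v \<times> 'v \<Rightarrow> real) \<Rightarrow> 'v set \<Rightarrow> real" where
  "exit_weight E w S = (\<Sum>e\<in>{e \<in> E. fst e \<in> S \<and> snd e \<notin> S}. w e)"

text \<open>An infimum in the reals: for \<open>w\<close> nonnegative on \<open>E\<close> the set is bounded below by \<open>0\<close>,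
  and it is nonempty as soon as \<open>E\<close> contains a directed cycle.\<close>

definition kappa0 :: "('v \<times> 'v) set \<Rightarrow> ('v \<times> 'v \<Rightarrow> real) \<Rightarrow> real" where
  "kappa0 E w = Inf {exit_weight E w S | S. finite S \<and> S \<noteq> {} \<and> strongly_connected E S}"

end

theory Submission
  imports Defs
begin

text \<open>Grouping the edges that leave a finite set \<open>S\<close> by their step \<open>i \<in> N\<close> writes the exit weight
  as \<open>\<Sum>i\<in>N. \<alpha> i * c S i\<close>, where the vector of exit counts \<open>c S\<close> consists of natural numbers and
  does not depend on the weights (\<open>exit_weight_eq_sum_exit_count\<close>). If the counts of \<open>T\<close> are at
  most those of \<open>S\<close> in every coordinate, the exit weight of \<open>T\<close> is at most that of \<open>S\<close> for all
  positive weights at once. By Dickson's lemma, there are finitely many finite strongly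
  connected sets such that the count vector of any other one is at least that of some member of
  this family (\<open>dickson_finite_basis\<close>). The infimum \<open>kappa0\<close> is therefore a minimum over the family,
  which is nonempty because the vertices of a closed walk form a finite strongly connected set
  (\<open>closed_walk_finite_strongly_connected\<close>).\<close>

text \<open>Dickson's lemma. In the induction on the set of coordinates, a family \<open>T0\<close> that is dominating
  for the old coordinates also handles the new coordinate \<open>j\<close>, except for those \<open>a\<close> whose \<open>j\<close>-th
  entry is below a common bound \<open>M\<close> of the \<open>j\<close>-th entries occurring in \<open>T0\<close>. These fall into finitely
  many slices on which the \<open>j\<close>-th entry is constant, and the induction hypothesis applies to each
  slice.\<close>

lemma dickson_finite_basis:
  fixes c :: "'a \<Rightarrow> 'i \<Rightarrow> nat"
  assumes "finite I"
  shows "\<exists>T\<subseteq>A. finite T \<and> (\<forall>a\<in>A. \<exists>t\<in>T. \<forall>i\<in>I. c t i \<le> c a i)"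
  using assms
proof (induction I arbitrary: A rule: finite_induct)
  case empty
  show ?case
  proof (cases "A = {}")
    case False
    then obtain a where "a \<in> A" by blast
    then show ?thesis by (intro exI[of _ "{a}"]) auto
  qed auto
next
  case (insert j I)
  obtain T0 where T0: "T0 \<subseteq> A" "finite T0" "\<forall>a\<in>A. \<exists>t\<in>T0. \<forall>i\<in>I. c t i \<le> c a i"
    using insert.IH[of A] by auto
  obtain M where M: "\<forall>t\<in>T0. c t j \<le> M"
    using finite_nat_set_iff_bounded_le[of "(\<lambda>t. c t j) ` T0"] T0(2) by auto
  define slice where "slice m = {a \<in> A. c a j = m}" for m
  have "\<forall>m. \<exists>T\<subseteq>slice m. finite T \<and> (\<forall>a\<in>slice m. \<exists>t\<in>T. \<forall>i\<in>I. c t i \<le> c a i)"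
    by (intro allI insert.IH)
  then obtain U where U: "\<And>m. U m \<subseteq> slice m" "\<And>m. finite (U m)"
    "\<And>m a. a \<in> slice m \<Longrightarrow> \<exists>t\<in>U m. \<forall>i\<in>I. c t i \<le> c a i"
    by metis
  define T where "T = T0 \<union> (\<Union>m<M. U m)"
  have "T \<subseteq> A" "finite T"
    using T0(1,2) U(1,2) unfolding T_def slice_def by blast+
  moreover have "\<exists>t\<in>T. \<forall>i\<in>insert j I. c t i \<le> c a i" if a: "a \<in> A" for a
  proof (cases "c a j < M")
    case True
    obtain t where t: "t \<in> U (c a j)" "\<forall>i\<in>I. c t i \<le> c a i"
      using U(3)[of a "c a j"] a by (auto simp: slice_def)
    then have "c t j = c a j" "t \<in> T"
      using U(1)[of "c a j"] True by (auto simp: slice_def T_def)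
    with t show ?thesis by (intro bexI[of _ t]) auto
  next
    case False
    obtain t where t: "t \<in> T0" "\<forall>i\<in>I. c t i \<le> c a i"
      using T0(3) a by blast
    moreover have "c t j \<le> c a j"
      using M t(1) False by (meson not_less order_trans)
    ultimately show ?thesis by (intro bexI[of _ t]) (auto simp: T_def)
  qed
  ultimately show ?case by blast
qed

text \<open>The set \<open>S\<close> collects the vertices of a walk from \<open>x\<close> to \<open>y\<close>. Recording that every vertex of
  \<open>S\<close> lies between \<open>x\<close> and \<open>y\<close> inside \<open>S\<close> makes \<open>S\<close> strongly connected once the walk closes up.\<close>

lemma finite_walk_support:
  assumes "(x, y) \<in> E\<^sup>+"
  shows "\<exists>S. finite S \<and> x \<in> S \<and> (x, y) \<in> (E \<inter> S \<times> S)\<^sup>+ \<and>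
    (\<forall>z\<in>S. (x, z) \<in> (E \<inter> S \<times> S)\<^sup>* \<and> (z, y) \<in> (E \<inter> S \<times> S)\<^sup>*)"
  using assms
proof (induction rule: trancl_induct)
  case (base y)
  then have "(x, y) \<in> E \<inter> {x, y} \<times> {x, y}" by simp
  then show ?case by (intro exI[of _ "{x, y}"]) auto
next
  case (step y z)
  then obtain S where S: "finite S" "x \<in> S" "(x, y) \<in> (E \<inter> S \<times> S)\<^sup>+"
    "\<forall>v\<in>S. (x, v) \<in> (E \<inter> S \<times> S)\<^sup>* \<and> (v, y) \<in> (E \<inter> S \<times> S)\<^sup>*"
    by blast
  define S' where "S' = insert z S"
  have sub: "E \<inter> S \<times> S \<subseteq> E \<inter> S' \<times> S'" by (auto simp: S'_def)
  have "y \<in> S" using S(3) by (auto elim: tranclE)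
  with step.hyps have yz: "(y, z) \<in> E \<inter> S' \<times> S'" by (auto simp: S'_def)
  have xz: "(x, z) \<in> (E \<inter> S' \<times> S')\<^sup>+"
    using trancl_mono[OF S(3) sub] yz by (rule trancl_into_trancl)
  have "(x, v) \<in> (E \<inter> S' \<times> S')\<^sup>* \<and> (v, z) \<in> (E \<inter> S' \<times> S')\<^sup>*" if "v \<in> S'" for v
  proof (cases "v = z")
    case True
    with xz show ?thesis by (simp add: trancl_into_rtrancl)
  next
    case False
    with that S(4) have "(x, v) \<in> (E \<inter> S \<times> S)\<^sup>*" "(v, y) \<in> (E \<inter> S \<times> S)\<^sup>*"
      by (auto simp: S'_def)
    then have "(x, v) \<in> (E \<inter> S' \<times> S')\<^sup>*" "(v, y) \<in> (E \<inter> S' \<times> S')\<^sup>*"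
      using rtrancl_mono[OF sub] by blast+
    with yz show ?thesis by (meson rtrancl.rtrancl_into_rtrancl)
  qed
  with xz S(1,2) show ?case by (intro exI[of _ S']) (auto simp: S'_def)
qed

lemma closed_walk_finite_strongly_connected:
  assumes "(x, x) \<in> E\<^sup>+"
  shows "\<exists>S. finite S \<and> strongly_connected E S"
proof -
  obtain S where S: "finite S" "x \<in> S" "(x, x) \<in> (E \<inter> S \<times> S)\<^sup>+"
    "\<forall>z\<in>S. (x, z) \<in> (E \<inter> S \<times> S)\<^sup>* \<and> (z, x) \<in> (E \<inter> S \<times> S)\<^sup>*"
    using finite_walk_support[OF assms] by blast
  have "(u, v) \<in> (E \<inter> S \<times> S)\<^sup>+" if "u \<in> S" "v \<in> S" for u v
    using S(3,4) that by (meson rtrancl_trancl_trancl trancl_rtrancl_trancl)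
  with S(1,2) show ?thesis by (auto simp: strongly_connected_def)
qed

definition exit_count :: "int set \<Rightarrow> int \<Rightarrow> nat" where
  "exit_count S i = card {x \<in> S. x + i \<notin> S}"

lemma exit_weight_eq_sum_exit_count:
  assumes "finite N" "finite S"
  shows "exit_weight (edges N) (weight \<alpha>) S = (\<Sum>i\<in>N. \<alpha> i * real (exit_count S i))"
proof -
  have "exit_weight (edges N) (weight \<alpha>) S = (\<Sum>(i, x)\<in>(SIGMA i:N. {x \<in> S. x + i \<notin> S}). \<alpha> i)"
    unfolding exit_weight_def
    by (rule sum.reindex_bij_witness[where i = "\<lambda>(i, x). (x, x + i)" and j = "\<lambda>(x, y). (y - x, x)"])
      (auto simp: edges_def weight_def)
  also have "\<dots> = (\<Sum>i\<in>N. \<Sum>x\<in>{x \<in> S. x + i \<notin> S}. \<alpha> i)"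
    using assms by (subst sum.Sigma) auto
  also have "\<dots> = (\<Sum>i\<in>N. \<alpha> i * real (exit_count S i))"
    by (simp add: exit_count_def mult.commute)
  finally show ?thesis .
qed

lemma exit_weight_mono_exit_count:
  assumes "finite N" "finite S" "finite T"
    and "\<And>i. i \<in> N \<Longrightarrow> \<alpha> i \<ge> 0" "\<And>i. i \<in> N \<Longrightarrow> exit_count T i \<le> exit_count S i"
  shows "exit_weight (edges N) (weight \<alpha>) T \<le> exit_weight (edges N) (weight \<alpha>) S"
  using assms by (auto simp: exit_weight_eq_sum_exit_count intro!: sum_mono mult_left_mono)

theorem theorem2p1:
  fixes L R :: int and N :: "int set"
  assumes "L > 0" and "R > 0"
    and "N \<subseteq> {-L..R}" and "-L \<in> N" and "R \<in> N"
    and "strongly_connected (edges N) UNIV"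
  shows "\<exists>\<S> :: int set set.
           finite \<S> \<and>
           (\<forall>S\<in>\<S>. finite S \<and> strongly_connected (edges N) S) \<and>
           (\<forall>\<alpha> :: int \<Rightarrow> real. (\<forall>i\<in>N. \<alpha> i > 0) \<longrightarrow>
              (\<exists>S\<in>\<S>. kappa0 (edges N) (weight \<alpha>) = exit_weight (edges N) (weight \<alpha>) S))"
proof -
  have fin: "finite N" using assms(3) finite_subset by blast
  define A where "A = {S. finite S \<and> strongly_connected (edges N) S}"
  have "(0, 0) \<in> (edges N)\<^sup>+"
    using assms(6) by (simp add: strongly_connected_def)
  then have "A \<noteq> {}"
    using closed_walk_finite_strongly_connected by (auto simp: A_def)
  obtain F where F: "F \<subseteq> A" "finite F"
    "\<forall>S\<in>A. \<exists>T\<in>F. \<forall>i\<in>N. exit_count T i \<le> exit_count S i"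
    using dickson_finite_basis[OF fin, of A exit_count] by blast
  have "F \<noteq> {}" using F(3) \<open>A \<noteq> {}\<close> by blast
  have "\<exists>S\<in>F. kappa0 (edges N) (weight \<alpha>) = exit_weight (edges N) (weight \<alpha>) S"
    if pos: "\<forall>i\<in>N. \<alpha> i > 0" for \<alpha>
  proof -
    let ?\<beta> = "exit_weight (edges N) (weight \<alpha>)"
    obtain T where T: "T \<in> F" "\<forall>S\<in>F. ?\<beta> T \<le> ?\<beta> S"
      using ex_is_arg_min_if_finite[OF F(2) \<open>F \<noteq> {}\<close>, of ?\<beta>] by (auto simp: is_arg_min_linorder)
    have "?\<beta> T \<le> ?\<beta> S" if S: "S \<in> A" for S
    proof -
      obtain T' where T': "T' \<in> F" "\<forall>i\<in>N. exit_count T' i \<le> exit_count S i"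
        using bspec[OF F(3) S] by blast
      have "?\<beta> T' \<le> ?\<beta> S"
        using T' S F(1) pos fin
        by (intro exit_weight_mono_exit_count) (auto simp: A_def less_imp_le)
      then show ?thesis using T(2) T'(1) by force
    qed
    moreover have "kappa0 (edges N) (weight \<alpha>) = Inf (?\<beta> ` A)"
      unfolding kappa0_def A_def
      by (rule arg_cong[where f = Inf]) (auto simp: strongly_connected_def)
    ultimately have "kappa0 (edges N) (weight \<alpha>) = ?\<beta> T"
      using T(1) F(1) by (auto intro!: cInf_eq_minimum)
    with T(1) show ?thesis by blast
  qed
  with F(1,2) show ?thesis by (intro exI[of _ F]) (auto simp: A_def)
qed

end
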